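(* Let $n \geq 2$ and $m\geq 1$ be integers, let $A\in\mathbb{R}^{n\times n}$ and let $B\in\mathbb{R}^{n\times m}$ be nonzero. Consider the linear time-invariant system $x(t+1) = A x(t) + B u(t)$, $t = 0, 1, 2, \ldots$, with $x(t)\in\mathbb{R}^n$ and $u(t)\in\mathbb{R}^m$. For each positive integer $T$ let $$\eta(A,B,T) = \frac{\operatorname{tr}\big(G_{(A,B,T)}^2\big)}{\big(\operatorname{tr} G_{(A,B,T)}\big)^2}, \qquad G_{(A,B,T)} = \sum_{t=0}^{T-1} A^t B B^\top (A^\top)^t .$$ If $\eta(A,B,T) < \frac{1}{n-1}$ for some positive integer $T$, then the system is controllable in the classical sense.
   Context: For a positive integer $T$ let $\mathcal{C}_{(A,B,T)} = \begin{pmatrix} B & AB & \cdots & A^{T-1}B\end{pmatrix}\in\mathbb{R}^{n\times Tm}$, so that $G_{(A,B,T)} = \mathcal{C}_{(A,B,T)}\mathcal{C}_{(A,B,T)}^\top$. The reachable space is $\mathcal{R}_{(A,B)} = \operatorname{image}(\mathcal{C}_{(A,B,n)})$ (column space), and the reachability index $\tau$ is the smallest positive integer $t$ with $\operatorname{image}(\mathcal{C}_{(A,B,t)}) = \mathcal{R}_{(A,B)}$. The system is controllable in the classical sense if for every $T\geq\tau$ and all $x_0, x_T\in\mathbb{R}^n$ there is a control sequence $(u(0),\ldots,u(T-1))$ that transfers the state from $x(0)=x_0$ to $x(T)=x_T$; equivalently, $\mathcal{C}_{(A,B,\tau)}$ has rank $n$. $\operatorname{tr}$ denotes the trace. *)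

theory Defs
  imports "HOL-Analysis.Analysis"
begin

(* The type class power "^" on "real^'n^'n" is componentwise, so powers with respect to the
   matrix product "**" need their own definition. *)
primrec matpow :: "real^'n^'n \<Rightarrow> nat \<Rightarrow> real^'n^'n" where
  "matpow A 0 = mat 1"
| "matpow A (Suc k) = A ** matpow A k"

definition gramian :: "real^'n^'n \<Rightarrow> real^'m^'n \<Rightarrow> nat \<Rightarrow> real^'n^'n" where
  "gramian A B T =
    (\<Sum>t<T. matpow A t ** B ** transpose B ** matpow (transpose A) t)"

definition eta :: "real^'n^'n \<Rightarrow> real^'m^'n \<Rightarrow> nat \<Rightarrow> real" where
  "eta A B T =
    trace (gramian A B T ** gramian A B T) / (trace (gramian A B T))\<^sup>2"

(* The n x Tm matrix C_T = (B  AB ... A^(T-1)B) is represented by its action on the stacked vector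
   (w 0, ..., w (T-1)) of R^(Tm), because T varies within the statement. Blocks w t with t >= T
   are ignored. *)
definition ctrb_mult ::
    "real^'n^'n \<Rightarrow> real^'m^'n \<Rightarrow> nat \<Rightarrow> (nat \<Rightarrow> real^'m) \<Rightarrow> real^'n" where
  "ctrb_mult A B T w = (\<Sum>t<T. (matpow A t ** B) *v w t)"

definition ctrb_image :: "real^'n^'n \<Rightarrow> real^'m^'n \<Rightarrow> nat \<Rightarrow> (real^'n) set" where
  "ctrb_image A B T = range (ctrb_mult A B T)"

definition reachable_space :: "real^'n^'n \<Rightarrow> real^'m^'n \<Rightarrow> (real^'n) set" where
  "reachable_space A B = ctrb_image A B CARD('n)"

(* The minimum is over a nonempty set: t = CARD('n) qualifies. *)
definition reachability_index :: "real^'n^'n \<Rightarrow> real^'m^'n \<Rightarrow> nat" where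
  "reachability_index A B = (LEAST t. t \<ge> 1 \<and> ctrb_image A B t = reachable_space A B)"

primrec state ::
    "real^'n^'n \<Rightarrow> real^'m^'n \<Rightarrow> real^'n \<Rightarrow> (nat \<Rightarrow> real^'m) \<Rightarrow> nat \<Rightarrow> real^'n" where
  "state A B x0 u 0 = x0"
| "state A B x0 u (Suc t) = A *v state A B x0 u t + B *v u t"

(* The state at time T depends only on u 0, ..., u (T-1), so u may be a total sequence. *)
definition controllable :: "real^'n^'n \<Rightarrow> real^'m^'n \<Rightarrow> bool" where
  "controllable A B \<longleftrightarrow>
    (\<forall>T \<ge> reachability_index A B. \<forall>x0 xT. \<exists>u. state A B x0 u T = xT)"

end

theory Submission
  imports Defs
begin

text \<open>If the reachable space is a proper subspace, a unit vector \<open>v\<close> orthogonal to it is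
  in the kernel of every Gramian \<open>G\<close>. With the projection \<open>P = I - v v\<^sup>T\<close> this gives
  \<open>tr G = tr (G P)\<close>, and the Cauchy-Schwarz inequality for the Frobenius inner product yields
  \<open>(tr G)\<^sup>2 \<le> tr (G\<^sup>2) tr (P\<^sup>2) = (n - 1) tr (G\<^sup>2)\<close>, i.e. \<open>\<eta> \<ge> 1 / (n - 1)\<close>.\<close>

text \<open>\<open>matpow\<close> multiplies by \<open>A\<close> on the left, whereas transposition
  moves that factor to the right; commutation reconciles the two.\<close>

lemma matpow_commute: "matpow A t ** A = A ** matpow A t"
  by (induction t) (simp_all flip: matrix_mul_assoc)

lemma transpose_matpow: "matpow (transpose A) t = transpose (matpow A t)"
  by (induction t) (simp_all add: transpose_mat matrix_transpose_mul flip: matpow_commute)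

lemma transpose_sum: "transpose (\<Sum>i\<in>I. f i) = (\<Sum>i\<in>I. transpose (f i))"
  by (simp add: vec_eq_iff transpose_def)

lemma trace_sum: "trace (\<Sum>i\<in>I. f i) = (\<Sum>i\<in>I. trace (f i))"
  by (simp add: trace_def) (rule sum.swap)

lemma sum_matrix_vector_mult: "(\<Sum>i\<in>I. f i) *v x = (\<Sum>i\<in>I. f i *v x)"
  by (induction I rule: infinite_finite_induct) (simp_all add: matrix_vector_mult_add_rdistrib)

text \<open>The inner product of matrices, seen as vectors of rows, is the Frobenius one, so
  Cauchy-Schwarz becomes available for traces.\<close>

lemma trace_mult_transpose_eq_inner:
  fixes M N :: "real^'m^'n"
  shows "trace (M ** transpose N) = M \<bullet> N"
  by (simp add: trace_def matrix_matrix_mult_def transpose_def inner_vec_def)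

lemma gramian_eq:
  "gramian A B T = (\<Sum>t<T. (matpow A t ** B) ** transpose (matpow A t ** B))"
  by (simp add: gramian_def transpose_matpow matrix_transpose_mul matrix_mul_assoc)

lemma transpose_gramian: "transpose (gramian A B T) = gramian A B T"
  by (simp add: gramian_eq transpose_sum matrix_transpose_mul)

text \<open>The trace is a sum of squared Frobenius norms whose term at 0 is that of
  \<open>B\<close>. This makes the denominator of \<open>eta\<close> nonzero.\<close>

lemma trace_gramian_pos:
  assumes "B \<noteq> 0" and "T \<ge> 1"
  shows "trace (gramian A B T) > 0"
proof -
  have "0 < B \<bullet> B"
    using assms by simp
  also have "B \<bullet> B = (matpow A 0 ** B) \<bullet> (matpow A 0 ** B)"
    by simp
  also have "\<dots> \<le> (\<Sum>t<T. (matpow A t ** B) \<bullet> (matpow A t ** B))"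
    using assms by (intro member_le_sum) auto
  also have "\<dots> = trace (gramian A B T)"
    by (simp add: gramian_eq trace_sum trace_mult_transpose_eq_inner)
  finally show ?thesis .
qed

lemma trace_square_le_if_kernel:
  fixes G :: "real^'n^'n" and v :: "real^'n"
  assumes sym: "transpose G = G" and kernel: "G *v v = 0" and unit: "norm v = 1"
  shows "(trace G)\<^sup>2 \<le> (real CARD('n) - 1) * trace (G ** G)"
proof -
  define V :: "real^'n^'n" where "V = (\<chi> i j. v$i * v$j)"
  define P where "P = mat 1 - V"
  have vv: "(\<Sum>i\<in>UNIV. v$i * v$i) = 1"
    using unit by (simp add: norm_eq_1 inner_vec_def)
  have I_inner: "mat 1 \<bullet> M = trace M" for M :: "real^'n^'n"
    by (simp add: inner_vec_def trace_def mat_def if_distrib[of "\<lambda>c. c * _"] cong: if_cong)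
  \<comment> \<open>Pairing \<open>G\<close> with \<open>V\<close> gives the quadratic form of
    \<open>G\<close> at \<open>v\<close>, which vanishes on the kernel.\<close>
  have "G \<bullet> V = (\<Sum>i\<in>UNIV. v$i * (G *v v)$i)"
    by (simp add: V_def inner_vec_def matrix_vector_mult_def sum_distrib_left mult_ac)
  then have GP: "G \<bullet> P = trace G"
    by (simp add: P_def inner_diff_right inner_commute[of G "mat 1"] I_inner kernel)
  \<comment> \<open>With \<open>V \<bullet> V\<close> and \<open>trace V\<close> both 1, expanding
    \<open>P \<bullet> P\<close> gives n - 2 + 1.\<close>
  have "V \<bullet> V = (\<Sum>i\<in>UNIV. v$i * v$i * (\<Sum>j\<in>UNIV. v$j * v$j))"
    by (simp add: V_def inner_vec_def sum_distrib_left mult_ac)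
  moreover have "trace V = 1"
    by (simp add: V_def trace_def vv)
  ultimately have PP: "P \<bullet> P = real CARD('n) - 1"
    by (simp add: P_def inner_diff_right inner_diff_left inner_commute[of V "mat 1"] I_inner vv
        trace_I)
  have GG: "G \<bullet> G = trace (G ** G)"
    using trace_mult_transpose_eq_inner[of G G] sym by simp
  show ?thesis
    using Cauchy_Schwarz_ineq[of G P] by (simp add: GP PP GG mult.commute)
qed

text \<open>Horner's scheme: all blocks after the first share a factor \<open>A\<close> on the
  left.\<close>

lemma ctrb_mult_Suc:
  "ctrb_mult A B (Suc t) w = B *v w 0 + A *v ctrb_mult A B t (\<lambda>i. w (Suc i))"
  by (simp add: ctrb_mult_def sum.lessThan_Suc_shift linear_sum[OF matrix_vector_mul_linear]
      matrix_vector_mul_assoc matrix_mul_assoc del: sum.lessThan_Suc)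

lemma ctrb_image_Suc:
  "ctrb_image A B (Suc t) = (\<lambda>(u, x). B *v u + A *v x) ` (UNIV \<times> ctrb_image A B t)"
proof (intro equalityI subsetI)
  fix y assume "y \<in> ctrb_image A B (Suc t)"
  then show "y \<in> (\<lambda>(u, x). B *v u + A *v x) ` (UNIV \<times> ctrb_image A B t)"
    by (force simp: ctrb_image_def ctrb_mult_Suc)
next
  fix y assume "y \<in> (\<lambda>(u, x). B *v u + A *v x) ` (UNIV \<times> ctrb_image A B t)"
  then obtain u w where "y = B *v u + A *v ctrb_mult A B t w"
    by (auto simp: ctrb_image_def)
  \<comment> \<open>\<open>case_nat u w\<close> puts the block \<open>u\<close> in front of the
    sequence \<open>w\<close>.\<close>
  then have "y = ctrb_mult A B (Suc t) (case_nat u w)"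
    by (simp add: ctrb_mult_Suc)
  then show "y \<in> ctrb_image A B (Suc t)"
    by (simp add: ctrb_image_def)
qed

lemma subspace_ctrb_image: "subspace (ctrb_image A B t)"
proof (rule subspaceI)
  have "ctrb_mult A B t (\<lambda>_. 0) = 0"
    by (simp add: ctrb_mult_def)
  then show "0 \<in> ctrb_image A B t"
    unfolding ctrb_image_def by (metis rangeI)
next
  fix x y assume "x \<in> ctrb_image A B t" "y \<in> ctrb_image A B t"
  then obtain w z where "x = ctrb_mult A B t w" "y = ctrb_mult A B t z"
    by (auto simp: ctrb_image_def)
  then have "x + y = ctrb_mult A B t (\<lambda>i. w i + z i)"
    by (simp add: ctrb_mult_def matrix_vector_right_distrib sum.distrib)
  then show "x + y \<in> ctrb_image A B t"
    by (simp add: ctrb_image_def)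
next
  fix c x assume "x \<in> ctrb_image A B t"
  then obtain w where "x = ctrb_mult A B t w"
    by (auto simp: ctrb_image_def)
  then have "c *\<^sub>R x = ctrb_mult A B t (\<lambda>i. c *\<^sub>R w i)"
    by (simp add: ctrb_mult_def matrix_vector_mult_scaleR scaleR_sum_right)
  then show "c *\<^sub>R x \<in> ctrb_image A B t"
    by (simp add: ctrb_image_def)
qed

lemma ctrb_image_mono:
  assumes "s \<le> t"
  shows "ctrb_image A B s \<subseteq> ctrb_image A B t"
proof
  fix x assume "x \<in> ctrb_image A B s"
  then obtain w where "x = ctrb_mult A B s w"
    by (auto simp: ctrb_image_def)
  also have "\<dots> = ctrb_mult A B t (\<lambda>i. if i < s then w i else 0)"
    unfolding ctrb_mult_def using assms by (intro sum.mono_neutral_cong_left) auto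
  finally show "x \<in> ctrb_image A B t"
    by (simp add: ctrb_image_def)
qed

text \<open>By \<open>ctrb_image_Suc\<close> each image is determined by the preceding one, so a
  single repetition freezes the chain.\<close>

lemma ctrb_image_stationary:
  assumes "ctrb_image A B (Suc t) = ctrb_image A B t"
  shows "ctrb_image A B (t + k) = ctrb_image A B t"
  by (induction k) (use assms in \<open>simp_all add: ctrb_image_Suc\<close>)

text \<open>A dimension count takes the place of Cayley-Hamilton: the increasing chain of subspaces
  must repeat at some index at most n, and is constant from there on.\<close>

lemma ctrb_image_subset_reachable_space:
  fixes A :: "real^'n^'n" and B :: "real^'m^'n"
  shows "ctrb_image A B k \<subseteq> reachable_space A B"
proof -
  have "\<exists>t\<le>CARD('n). ctrb_image A B (Suc t) = ctrb_image A B t"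
  proof (rule ccontr)
    assume "\<not> ?thesis"
    then have neq: "ctrb_image A B (Suc t) \<noteq> ctrb_image A B t" if "t \<le> CARD('n)" for t
      using that by blast
    \<comment> \<open>Strict growth at every index up to n would force dimension n + 1 at index n +
      1.\<close>
    have "t \<le> dim (ctrb_image A B t)" if "t \<le> Suc CARD('n)" for t
      using that
    proof (induction t)
      case (Suc t)
      then have "ctrb_image A B t \<subset> ctrb_image A B (Suc t)"
        using neq[of t] ctrb_image_mono[of t "Suc t" A B] by auto
      then have "dim (ctrb_image A B t) < dim (ctrb_image A B (Suc t))"
        by (intro dim_psubset) (simp add: subspace_ctrb_image span_eq_iff[THEN iffD2])
      then show ?case
        using Suc by simp
    qed simp
    from this[of "Suc CARD('n)"] show False
      using dim_subset_UNIV[of "ctrb_image A B (Suc CARD('n))"] by simp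
  qed
  then obtain t where t: "t \<le> CARD('n)" "ctrb_image A B (Suc t) = ctrb_image A B t"
    by blast
  have "ctrb_image A B k \<subseteq> ctrb_image A B (t + k)"
    by (rule ctrb_image_mono) simp
  also have "\<dots> \<subseteq> ctrb_image A B CARD('n)"
    using ctrb_image_stationary[OF t(2)] ctrb_image_mono[OF t(1)] by simp
  finally show ?thesis
    by (simp add: reachable_space_def)
qed

lemma ctrb_image_reachability_index:
  fixes A :: "real^'n^'n" and B :: "real^'m^'n"
  shows "ctrb_image A B (reachability_index A B) = reachable_space A B"
proof -
  have "CARD('n) \<ge> 1 \<and> ctrb_image A B CARD('n) = reachable_space A B"
    by (simp add: reachable_space_def Suc_le_eq)
  then show ?thesis
    unfolding reachability_index_def
    using LeastI[of "\<lambda>t. t \<ge> 1 \<and> ctrb_image A B t = reachable_space A B"] by blast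
qed

text \<open>The latest input has been multiplied by \<open>A\<close> the fewest times, so the inputs
  fill the blocks in reversed time order.\<close>

lemma state_eq:
  "state A B x0 u T = matpow A T *v x0 + ctrb_mult A B T (\<lambda>t. u (T - Suc t))"
proof (induction T)
  case 0
  show ?case
    by (simp add: ctrb_mult_def)
next
  case (Suc T)
  then show ?case
    by (simp add: ctrb_mult_Suc matrix_vector_right_distrib matrix_vector_mul_assoc)
qed

lemma controllable_if_reachable_space_UNIV:
  assumes "reachable_space A B = UNIV"
  shows "controllable A B"
  unfolding controllable_def
proof (intro allI impI)
  fix T x0 xT assume "T \<ge> reachability_index A B"
  then have "ctrb_image A B T = UNIV"
    using ctrb_image_mono[of "reachability_index A B" T A B] assms
    by (auto simp: ctrb_image_reachability_index)
  then obtain w where w: "xT - matpow A T *v x0 = ctrb_mult A B T w"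
    unfolding ctrb_image_def by (metis UNIV_I imageE)
  \<comment> \<open>Reversing twice restores the index only for \<open>t < T\<close>, and
    \<open>ctrb_mult\<close> reads no other blocks.\<close>
  have "ctrb_mult A B T (\<lambda>t. w (T - Suc (T - Suc t))) = ctrb_mult A B T w"
    by (auto simp: ctrb_mult_def intro!: sum.cong)
  then have "state A B x0 (\<lambda>t. w (T - Suc t)) T = xT"
    by (simp add: state_eq flip: w)
  then show "\<exists>u. state A B x0 u T = xT"
    by blast
qed

text \<open>Orthogonality to all columns of \<open>matpow A t ** B\<close> means that its transpose,
  the right factor of each summand of the Gramian, kills \<open>v\<close>.\<close>

lemma gramian_kernel:
  assumes "\<And>x. x \<in> reachable_space A B \<Longrightarrow> v \<bullet> x = 0"
  shows "gramian A B T *v v = 0"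
proof -
  have "transpose (matpow A t ** B) *v v = 0" for t
  proof -
    have "(matpow A t ** B) *v w \<in> reachable_space A B" for w
    proof -
      \<comment> \<open>Only block \<open>t\<close> is nonzero. Since \<open>t\<close> may exceed n,
        the stabilization of the chain is needed to land in the reachable space.\<close>
      have "(matpow A t ** B) *v w = ctrb_mult A B (Suc t) (\<lambda>i. if i = t then w else 0)"
        by (simp add: ctrb_mult_def)
      then show ?thesis
        using ctrb_image_subset_reachable_space[of A B "Suc t"] by (auto simp: ctrb_image_def)
    qed
    then have "(transpose (matpow A t ** B) *v v) \<bullet> w = 0" for w
      using assms by (simp add: dot_lmul_matrix)
    then show ?thesis
      using inner_eq_zero_iff by blast
  qed
  then show ?thesis
    by (simp add: gramian_eq sum_matrix_vector_mult flip: matrix_vector_mul_assoc)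
qed

theorem proposition14:
  fixes A :: "real^'n^'n" and B :: "real^'m^'n"
  assumes "CARD('n) \<ge> 2"
    and "B \<noteq> 0"
    and "\<exists>T\<ge>1. eta A B T < 1 / (real CARD('n) - 1)"
  shows "controllable A B"
proof (rule controllable_if_reachable_space_UNIV, rule ccontr)
  assume "reachable_space A B \<noteq> UNIV"
  \<comment> \<open>A subspace equals its span, so a proper reachable space has a nonzero normal
    vector.\<close>
  then have "span (reachable_space A B) \<noteq> UNIV"
    by (simp add: reachable_space_def subspace_ctrb_image span_eq_iff[THEN iffD2])
  then obtain a where a: "a \<noteq> 0" "span (reachable_space A B) \<subseteq> {x. a \<bullet> x = 0}"
    using span_not_UNIV_orthogonal by blast
  define v where "v = a /\<^sub>R norm a"
  obtain T where T: "T \<ge> 1" "eta A B T < 1 / (real CARD('n) - 1)"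
    using assms(3) by blast
  have "v \<bullet> x = 0" if "x \<in> reachable_space A B" for x
    using a(2) span_base[OF that] by (auto simp: v_def)
  then have "gramian A B T *v v = 0"
    by (rule gramian_kernel)
  moreover have "norm v = 1"
    using a(1) by (simp add: v_def)
  ultimately have "(trace (gramian A B T))\<^sup>2
      \<le> (real CARD('n) - 1) * trace (gramian A B T ** gramian A B T)"
    by (intro trace_square_le_if_kernel transpose_gramian)
  \<comment> \<open>Both divisors, n - 1 and the squared trace, are positive.\<close>
  then have "1 / (real CARD('n) - 1) \<le> eta A B T"
    using assms(1) trace_gramian_pos[OF assms(2) T(1), of A]
    by (simp add: eta_def field_simps)
  with T(2) show False
    by simp
qed

end
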